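(* Let $\mathcal{M}$ be a finite set of goods. Every generalized network utility function $u:\mathbb{R}_{\ge0}^{\mathcal{M}}\to\mathbb{R}_{\ge0}$ is Gale-substitutes.
   Context: Generalized flow instance: a finite directed graph $G=(V,E)$ (parallel arcs allowed) with a sink $t\in V$, a supply set $S\subseteq V\setminus\{t\}$, arc capacities $h_e\in\mathbb{R}_{\ge0}\cup\{\infty\}$ and gain factors $\gamma_e>0$, $e\in E$. For $\mathbf{f}\in\mathbb{R}_{\ge0}^E$ the net flow at $v$ is $\operatorname{net}_{\mathbf{f}}(v)=\sum_{e\text{ entering }v}\gamma_ef_e-\sum_{e\text{ leaving }v}f_e$. For a supply vector $\mathbf{x}\in\mathbb{R}_{\ge0}^S$, the maximum generalized flow value from supply $\mathbf{x}$ is the maximum of $\operatorname{net}_{\mathbf{f}}(t)$ over all $\mathbf{f}\in\mathbb{R}^E$ with $0\le f_e\le h_e$ for all $e\in E$, $\operatorname{net}_{\mathbf{f}}(v)\ge-x_v$ for all $v\in S$, and $\operatorname{net}_{\mathbf{f}}(v)\ge0$ for all $v\in V\setminus(S\cup\{t\})$. Generalized network utility function: $u:\mathbb{R}_{\ge0}^{\mathcal{M}}\to\mathbb{R}_{\ge0}$ such that $u(\mathbf{x})$ is the maximum generalized flow value from supply $\mathbf{x}$ in some generalized flow instance with supply set $S=\mathcal{M}$, where this value is finite for every supply vector, $u(\mathbf{0})=0$, and $u(\mathbf{x})>0$ for some $\mathbf{x}$. Gale demand: for $\mathbf{q}\in\mathbb{R}_{\ge0}^{\mathcal{M}}$, $b>0$,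 $\mathcal{GD}^u(\mathbf{q},b)=\arg\max_{\mathbf{y}\in\mathbb{R}_{\ge0}^{\mathcal{M}}}\ b\log u(\mathbf{y})-\langle\mathbf{q},\mathbf{y}\rangle$ (with $\log0=-\infty$). Its price domain is $\operatorname{pdom}(u)=\{\mathbf{q}\in\mathbb{R}_{\ge0}^{\mathcal{M}}:\exists b>0,\ \sup_{\mathbf{y}\in\mathbb{R}_{\ge0}^{\mathcal{M}}} b\log u(\mathbf{y})-\langle\mathbf{q},\mathbf{y}\rangle<+\infty\}$. $u$ is Gale-substitutes if: (i) for any $b>0$, $\mathbf{q},\mathbf{q}'\in\operatorname{pdom}(u)$ with $\mathbf{q}\ge\mathbf{q}'$ and $\mathbf{y}\in\mathcal{GD}^u(\mathbf{q},b)$, there exists $\mathbf{y}'\in\mathcal{GD}^u(\mathbf{q}',b)$ such that $y'_j\le y_j$ whenever $q'_j=q_j$; and (ii) for any $b\ge b'>0$, $\mathbf{q}\in\operatorname{pdom}(u)$ and $\mathbf{y}\in\mathcal{GD}^u(\mathbf{q},b)$, there exists $\mathbf{y}'\in\mathcal{GD}^u(\mathbf{q},b')$ with $\mathbf{y}'\le\mathbf{y}$. *)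

theory Defs
  imports "HOL-Analysis.Analysis" "Graph_Theory.Digraph"
begin

locale generalized_flow_instance = fin_digraph G
  for G :: "('v, 'e) pre_digraph" +
  fixes t :: 'v and S :: "'v set" and h :: "'e \<Rightarrow> ereal" and \<gamma> :: "'e \<Rightarrow> real"
  assumes sink_in_verts: "t \<in> verts G"
    and supply_subset: "S \<subseteq> verts G - {t}"
    and capacity_nonneg: "e \<in> arcs G \<Longrightarrow> 0 \<le> h e"
    and gain_pos: "e \<in> arcs G \<Longrightarrow> 0 < \<gamma> e"

definition net_flow ::
    "('v, 'e) pre_digraph \<Rightarrow> ('e \<Rightarrow> real) \<Rightarrow> ('e \<Rightarrow> real) \<Rightarrow> 'v \<Rightarrow> real" where
  "net_flow G \<gamma> f v = (\<Sum>e\<in>in_arcs G v. \<gamma> e * f e) - (\<Sum>e\<in>out_arcs G v. f e)"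

text \<open>Flows \<open>f\<close> and supplies \<open>x\<close> are total functions; only their values on the arcs of \<open>G\<close>
  and on \<open>S\<close>, respectively, matter.\<close>

definition feasible_flow ::
    "('v, 'e) pre_digraph \<Rightarrow> 'v \<Rightarrow> 'v set \<Rightarrow> ('e \<Rightarrow> ereal) \<Rightarrow> ('e \<Rightarrow> real) \<Rightarrow>
     ('v \<Rightarrow> real) \<Rightarrow> ('e \<Rightarrow> real) \<Rightarrow> bool" where
  "feasible_flow G t S h \<gamma> x f \<longleftrightarrow>
     (\<forall>e\<in>arcs G. 0 \<le> f e \<and> ereal (f e) \<le> h e) \<and>
     (\<forall>v\<in>S. net_flow G \<gamma> f v \<ge> - x v) \<and>
     (\<forall>v\<in>verts G - (S \<union> {t}). net_flow G \<gamma> f v \<ge> 0)"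

text \<open>A relation, because the maximum need not exist; that it holds for some real \<open>m\<close> expresses
  that the maximum generalized flow value is finite.\<close>

definition is_max_flow_value ::
    "('v, 'e) pre_digraph \<Rightarrow> 'v \<Rightarrow> 'v set \<Rightarrow> ('e \<Rightarrow> ereal) \<Rightarrow> ('e \<Rightarrow> real) \<Rightarrow>
     ('v \<Rightarrow> real) \<Rightarrow> real \<Rightarrow> bool" where
  "is_max_flow_value G t S h \<gamma> x m \<longleftrightarrow>
     (\<exists>f. feasible_flow G t S h \<gamma> x f \<and> net_flow G \<gamma> f t = m) \<and>
     (\<forall>f. feasible_flow G t S h \<gamma> x f \<longrightarrow> net_flow G \<gamma> f t \<le> m)"

text \<open>The goods are the elements of the finite type \<open>'m\<close>, and the injection \<open>s\<close> identifies them
  with the supply set of the instance. A utility function is only constrained on, and only ever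
  evaluated on, the nonnegative orthant. The two type arguments name the types from which the
  vertices and arcs of the instance are drawn.\<close>

definition generalized_network_utility ::
    "'v itself \<Rightarrow> 'e itself \<Rightarrow> (real ^ 'm::finite \<Rightarrow> real) \<Rightarrow> bool" where
  "generalized_network_utility (_ :: 'v itself) (_ :: 'e itself) u \<longleftrightarrow>
     (\<exists>(G :: ('v, 'e) pre_digraph) t S h \<gamma> (s :: 'm \<Rightarrow> 'v).
        generalized_flow_instance G t S h \<gamma> \<and> bij_betw s UNIV S \<and>
        (\<forall>x\<ge>0. is_max_flow_value G t S h \<gamma> (\<lambda>v. x $ inv s v) (u x))) \<and>
     (\<forall>x\<ge>0. 0 \<le> u x) \<and> u 0 = 0 \<and> (\<exists>x\<ge>0. u x > 0)"

definition gale_objective ::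
    "(real ^ 'm::finite \<Rightarrow> real) \<Rightarrow> real ^ 'm \<Rightarrow> real \<Rightarrow> real ^ 'm \<Rightarrow> ereal" where
  "gale_objective u q b y = (if u y = 0 then -\<infinity> else ereal (b * ln (u y) - inner q y))"

definition gale_demand ::
    "(real ^ 'm::finite \<Rightarrow> real) \<Rightarrow> real ^ 'm \<Rightarrow> real \<Rightarrow> (real ^ 'm) set" where
  "gale_demand u q b = {y. is_arg_max (gale_objective u q b) (\<lambda>y. 0 \<le> y) y}"

definition price_domain :: "(real ^ 'm::finite \<Rightarrow> real) \<Rightarrow> (real ^ 'm) set" where
  "price_domain u = {q. 0 \<le> q \<and> (\<exists>b>0. (SUP y\<in>{y. 0 \<le> y}. gale_objective u q b y) < \<infinity>)}"

definition gale_substitutes :: "(real ^ 'm::finite \<Rightarrow> real) \<Rightarrow> bool" where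
  "gale_substitutes u \<longleftrightarrow>
     (\<forall>b>0. \<forall>q\<in>price_domain u. \<forall>q'\<in>price_domain u. \<forall>y\<in>gale_demand u q b.
        q \<ge> q' \<longrightarrow>
        (\<exists>y'\<in>gale_demand u q' b. \<forall>j. q' $ j = q $ j \<longrightarrow> y' $ j \<le> y $ j)) \<and>
     (\<forall>b b'. b \<ge> b' \<and> b' > 0 \<longrightarrow>
        (\<forall>q\<in>price_domain u. \<forall>y\<in>gale_demand u q b. \<exists>y'\<in>gale_demand u q b'. y' \<le> y))"

end

theory Submission
  imports Defs
begin

text \<open>Let \<open>f\<close> and \<open>f'\<close> be optimal flows for a demand \<open>y\<close> at \<open>(q, b)\<close> and a demand \<open>y'\<close> at
  \<open>(q', b')\<close>, where \<open>q' \<le> q\<close> and \<open>b' \<le> b\<close>. View \<open>f' - f\<close> as a flow whose negative entries run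
  backwards along their arcs, and dye the part entering at the goods whose price is unchanged and
  whose supply increases. If the dye mixes perfectly at every vertex, it travels as a flow \<open>g\<close> that
  lies between \<open>0\<close> and \<open>f' - f\<close>, so \<open>f + g\<close> and \<open>f' - g\<close> are both feasible. Optimality of \<open>f\<close>
  against \<open>f + g\<close>, together with concavity of the logarithm, shows that \<open>f' - g\<close> is as good as
  \<open>f'\<close>, and it uses no more than \<open>y\<close> of each good whose price is unchanged. This needs a maximizer
  at \<open>(q', b')\<close>; one exists because the attainable pairs of flow value and cost form a projection
  of a polyhedron, hence a closed set.\<close>

section \<open>Splitting the difference of two flows\<close>

text \<open>Knaster-Tarski on the cube of functions into [0, 1]: the pointwise supremum of all
  \<open>r\<close> with \<open>r \<le> T r\<close> is a fixed point. It will supply consistent dye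
  fractions at all vertices at once, without solving a linear system.\<close>

lemma monotone_cube_fixpoint:
  fixes T :: "('a \<Rightarrow> real) \<Rightarrow> 'a \<Rightarrow> real"
  assumes mono: "\<And>r r' v. (\<And>w. 0 \<le> r w) \<Longrightarrow> (\<And>w. r w \<le> r' w) \<Longrightarrow> (\<And>w. r' w \<le> 1) \<Longrightarrow> T r v \<le> T r' v"
    and range: "\<And>r v. (\<And>w. 0 \<le> r w) \<Longrightarrow> (\<And>w. r w \<le> 1) \<Longrightarrow> T r v \<in> {0..1}"
  obtains r where "\<And>v. 0 \<le> r v" "\<And>v. r v \<le> 1" "\<And>v. T r v = r v"
proof -
  define A where "A = {r. (\<forall>v. 0 \<le> r v \<and> r v \<le> 1 \<and> r v \<le> T r v)}"
  define R where "R v = (SUP r\<in>A. r v)" for v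
  have zero: "(\<lambda>_. 0) \<in> A"
    using range[of "\<lambda>_. 0"] by (auto simp: A_def)
  have bdd: "bdd_above ((\<lambda>r. r v) ` A)" for v
    by (rule bdd_aboveI[of _ 1]) (auto simp: A_def)
  have upper: "r v \<le> R v" if "r \<in> A" for r v
    unfolding R_def using that bdd by (rule cSUP_upper)
  have R0: "0 \<le> R v" for v using upper[OF zero] .
  have R1: "R v \<le> 1" for v
    unfolding R_def using zero by (intro cSUP_least) (blast, simp add: A_def)
  have post: "R v \<le> T R v" for v
    unfolding R_def[of v]
  proof (rule cSUP_least)
    fix r assume r: "r \<in> A"
    then have "r v \<le> T r v" by (auto simp: A_def)
    also have "\<dots> \<le> T R v"
      by (rule mono) (use r upper R1 in \<open>auto simp: A_def\<close>)
    finally show "r v \<le> T R v" .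
  qed (use zero in auto)
  have TR: "T R v \<in> {0..1}" for v
    using R0 R1 by (rule range)
  have "T R \<in> A"
    unfolding A_def using TR by (auto intro!: mono R0 post)
  then have "T R v \<le> R v" for v by (rule upper)
  with post R0 R1 that show thesis by (meson order_antisym)
qed

text \<open>Supply is read as inflow from outside, zero off \<open>S\<close>, so that every vertex
  other than the sink has one constraint of the same form.\<close>

lemma (in generalized_flow_instance) feasible_flow_iff:
  "feasible_flow G t S h \<gamma> x f \<longleftrightarrow>
     (\<forall>e\<in>arcs G. 0 \<le> f e \<and> ereal (f e) \<le> h e) \<and>
     (\<forall>v\<in>verts G - {t}. 0 \<le> net_flow G \<gamma> f v + (if v \<in> S then x v else 0))"
proof -
  have "(\<forall>v\<in>verts G - {t}. 0 \<le> net_flow G \<gamma> f v + (if v \<in> S then x v else 0)) \<longleftrightarrow>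
     (\<forall>v\<in>S. net_flow G \<gamma> f v \<ge> - x v) \<and> (\<forall>v\<in>verts G - (S \<union> {t}). net_flow G \<gamma> f v \<ge> 0)"
    (is "?L = ?R")
  proof
    assume L: ?L
    show ?R
    proof (intro conjI ballI)
      fix v assume "v \<in> S"
      with L supply_subset show "net_flow G \<gamma> f v \<ge> - x v" by force
    next
      fix v assume "v \<in> verts G - (S \<union> {t})"
      with L[rule_format, of v] show "net_flow G \<gamma> f v \<ge> 0" by simp
    qed
  next
    assume ?R
    then show ?L by (auto simp: add.commute le_diff_eq)
  qed
  then show ?thesis by (simp add: feasible_flow_def)
qed

lemma net_flow_add:
  "net_flow G \<gamma> (\<lambda>e. f e + g e) v = net_flow G \<gamma> f v + net_flow G \<gamma> g v"
  by (simp add: net_flow_def sum.distrib algebra_simps)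

lemma net_flow_diff:
  "net_flow G \<gamma> (\<lambda>e. f e - g e) v = net_flow G \<gamma> f v - net_flow G \<gamma> g v"
  by (simp add: net_flow_def sum_subtractf algebra_simps)

lemma net_flow_cmult:
  "net_flow G \<gamma> (\<lambda>e. c * f e) v = c * net_flow G \<gamma> f v"
  by (simp add: net_flow_def sum_distrib_left algebra_simps)

lemma between_capacity:
  fixes a b c :: real
  assumes "0 \<le> a \<and> ereal a \<le> H" "0 \<le> b \<and> ereal b \<le> H" "min a b \<le> c" "c \<le> max a b"
  shows "0 \<le> c \<and> ereal c \<le> H"
  using assms by (cases H) (auto simp: min_def max_def split: if_splits)

text \<open>All of the supply increase on \<open>P\<close> is dyed. Dye leaves the network only
  where supply falls, where the slack of a vertex constraint grows, or at the sink, which receives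
  the amount \<open>a\<close>. Since the dyed part \<open>g\<close> is a portion of
  \<open>f' - f\<close>, moving it from \<open>f'\<close> to \<open>f\<close> keeps both flows
  feasible.\<close>

lemma (in generalized_flow_instance) flow_exchange:
  assumes f: "feasible_flow G t S h \<gamma> x f" and f': "feasible_flow G t S h \<gamma> x' f'"
    and P: "P \<subseteq> S" "\<forall>v\<in>P. x v \<le> x' v"
  obtains d g a where
    "feasible_flow G t S h \<gamma> (\<lambda>v. x v + d v) (\<lambda>e. f e + g e)"
    "feasible_flow G t S h \<gamma> (\<lambda>v. x' v - d v) (\<lambda>e. f' e - g e)"
    "net_flow G \<gamma> (\<lambda>e. f e + g e) t = net_flow G \<gamma> f t + a"
    "net_flow G \<gamma> (\<lambda>e. f' e - g e) t = net_flow G \<gamma> f' t - a"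
    "0 \<le> a" "a \<le> max 0 (net_flow G \<gamma> f' t - net_flow G \<gamma> f t)"
    "\<And>v. v \<in> P \<Longrightarrow> d v = x' v - x v"
    "\<And>v. v \<notin> P \<Longrightarrow> d v \<le> 0 \<and> min 0 (x' v - x v) \<le> d v"
proof -
  define pos where "pos r = max 0 r" for r :: real
  define neg where "neg r = max 0 (- r)" for r :: real
  have pn: "r = pos r - neg r" "0 \<le> pos r" "0 \<le> neg r" for r
    by (auto simp: pos_def neg_def)
  define \<delta> where "\<delta> e = f' e - f e" for e
  define Y where "Y v = (if v \<in> S then x' v - x v else 0)" for v
  \<comment> \<open>The change of slack in the constraint at \<open>v\<close>; at the sink, which is
    not in \<open>S\<close>, it is the change of the flow value.\<close>
  define \<sigma> where "\<sigma> v = net_flow G \<gamma> \<delta> v + Y v" for v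
  \<comment> \<open>Everything that enters \<open>v\<close>: increases on arcs into
    \<open>v\<close>, decreases on arcs out of \<open>v\<close> (these run backwards into
    \<open>v\<close>), new supply, and slack given up.\<close>
  define I where "I v = (\<Sum>e\<in>in_arcs G v. \<gamma> e * pos (\<delta> e)) + (\<Sum>e\<in>out_arcs G v. neg (\<delta> e))
      + pos (Y v) + neg (\<sigma> v)" for v
  \<comment> \<open>The dyed part of this inflow when the vertices have dyed fractions
    \<open>r\<close>: new supply is dyed only on \<open>P\<close>, and slack given up brings no
    dye.\<close>
  define N where "N r v = (\<Sum>e\<in>in_arcs G v. \<gamma> e * (r (tail G e) * pos (\<delta> e)))
      + (\<Sum>e\<in>out_arcs G v. r (head G e) * neg (\<delta> e))
      + (if v \<in> P then pos (Y v) else 0)" for r v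
  have \<gamma>0: "0 \<le> \<gamma> e" if "e \<in> in_arcs G v" for e v
    using gain_pos[of e] that by auto
  have N_mono: "N r v \<le> N r' v" if "\<And>w. r w \<le> r' w" for r r' v
    unfolding N_def using that pn \<gamma>0
    by (intro add_mono sum_mono mult_left_mono mult_right_mono) auto
  have N_nonneg: "0 \<le> N r v" if "\<And>w. 0 \<le> r w" for r v
    unfolding N_def using that pn \<gamma>0
    by (intro add_nonneg_nonneg sum_nonneg mult_nonneg_nonneg) auto
  have N_1: "N (\<lambda>_. 1) v \<le> I v" for v
    unfolding N_def I_def using pn by (auto intro!: add_increasing2)
  have N_le: "N r v \<le> I v" if "\<And>w. r w \<le> 1" for r v
    using N_mono[of r "\<lambda>_. 1" v] that N_1 by (meson order_trans)
  have I_nonneg: "0 \<le> I v" for v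
    using N_nonneg[of "\<lambda>_. 1" v] N_1[of v] by simp
  \<comment> \<open>\<open>\<rho> v\<close> is the dyed fraction of the flow \<open>I v\<close> through \<open>v\<close>. If \<open>I v = 0\<close>, then division by zero
    makes it \<open>0\<close>.\<close>
  obtain \<rho> where \<rho>: "\<And>v. 0 \<le> \<rho> v" "\<And>v. \<rho> v \<le> 1" and fp: "\<And>v. N \<rho> v / I v = \<rho> v"
  proof (rule monotone_cube_fixpoint[of "\<lambda>r v. N r v / I v"])
    show "N r v / I v \<le> N r' v / I v" if "\<And>w. r w \<le> r' w" for r r' v
      using N_mono[OF that] I_nonneg by (simp add: divide_right_mono)
    show "N r v / I v \<in> {0..1}" if "\<And>w. 0 \<le> r w" "\<And>w. r w \<le> 1" for r v
      using N_nonneg[of r v, OF that(1)] N_le[of r v, OF that(2)] by (auto simp: divide_le_eq_1)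
  qed blast
  have \<rho>I: "\<rho> v * I v = N \<rho> v" for v
  proof (cases "I v = 0")
    case True
    then show ?thesis using N_nonneg[of \<rho> v, OF \<rho>(1)] N_le[of \<rho> v, OF \<rho>(2)] by simp
  next
    case False
    then show ?thesis using fp[of v] by (simp add: field_simps)
  qed
  define g where "g e = \<rho> (tail G e) * pos (\<delta> e) - \<rho> (head G e) * neg (\<delta> e)" for e
  define d where "d v = (if v \<in> P then pos (x' v - x v) else 0) - \<rho> v * neg (x' v - x v)" for v
  define D where "D v = (if v \<in> S then d v else 0)" for v
  have D: "D v = (if v \<in> P then pos (Y v) else 0) - \<rho> v * neg (Y v)" for v
    using P by (auto simp: D_def d_def Y_def pos_def neg_def)
  \<comment> \<open>Conservation of dye. Inflow \<open>I v\<close> equals outflow, all outflow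
    carries the fraction \<open>\<rho> v\<close>, and the part not accounted for by \<open>g\<close>
    and \<open>D\<close> goes into growing slack.\<close>
  have balance: "net_flow G \<gamma> g v + D v = \<rho> v * pos (\<sigma> v)" for v
  proof -
    have 1: "(\<Sum>e\<in>in_arcs G v. \<gamma> e * g e)
        = (\<Sum>e\<in>in_arcs G v. \<gamma> e * (\<rho> (tail G e) * pos (\<delta> e))) - \<rho> v * (\<Sum>e\<in>in_arcs G v. \<gamma> e * neg (\<delta> e))"
      unfolding sum_distrib_left sum_subtractf[symmetric]
      by (rule sum.cong) (auto simp: g_def algebra_simps)
    have 2: "(\<Sum>e\<in>out_arcs G v. g e)
        = \<rho> v * (\<Sum>e\<in>out_arcs G v. pos (\<delta> e)) - (\<Sum>e\<in>out_arcs G v. \<rho> (head G e) * neg (\<delta> e))"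
      unfolding sum_distrib_left sum_subtractf[symmetric]
      by (rule sum.cong) (auto simp: g_def algebra_simps)
    have 3: "net_flow G \<gamma> \<delta> v = (\<Sum>e\<in>in_arcs G v. \<gamma> e * pos (\<delta> e)) - (\<Sum>e\<in>in_arcs G v. \<gamma> e * neg (\<delta> e))
        - (\<Sum>e\<in>out_arcs G v. pos (\<delta> e)) + (\<Sum>e\<in>out_arcs G v. neg (\<delta> e))"
    proof -
      have "net_flow G \<gamma> \<delta> v = net_flow G \<gamma> (\<lambda>e. pos (\<delta> e) - neg (\<delta> e)) v"
        using pn(1) by presburger
      then show ?thesis by (simp add: net_flow_diff) (simp add: net_flow_def)
    qed
    have "I v = (\<Sum>e\<in>out_arcs G v. pos (\<delta> e)) + (\<Sum>e\<in>in_arcs G v. \<gamma> e * neg (\<delta> e))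
        + neg (Y v) + pos (\<sigma> v)"
      using 3 \<sigma>_def[of v] pn(1)[of "\<sigma> v"] pn(1)[of "Y v"] unfolding I_def by linarith
    then have "N \<rho> v = \<rho> v * (\<Sum>e\<in>out_arcs G v. pos (\<delta> e))
        + \<rho> v * (\<Sum>e\<in>in_arcs G v. \<gamma> e * neg (\<delta> e)) + \<rho> v * neg (Y v) + \<rho> v * pos (\<sigma> v)"
      by (simp add: \<rho>I[symmetric] distrib_left)
    then show ?thesis unfolding D net_flow_def 1 2 N_def by linarith
  qed
  have shrink: "- neg r \<le> \<rho> v * pos r - \<rho> w * neg r" "\<rho> v * pos r - \<rho> w * neg r \<le> pos r" for v w r
    using \<rho> mult_left_le_one_le[of "pos r" "\<rho> v", OF pn(2) \<rho>] mult_left_le_one_le[of "neg r" "\<rho> w", OF pn(3) \<rho>]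
      mult_nonneg_nonneg[OF \<rho>(1)[of v] pn(2)[of r]] mult_nonneg_nonneg[OF \<rho>(1)[of w] pn(3)[of r]]
    by linarith+
  \<comment> \<open>One of \<open>pos (\<delta> e)\<close> and \<open>neg (\<delta> e)\<close>
    vanishes, so \<open>f + g\<close> and \<open>f' - g\<close> both stay between \<open>f\<close>
    and \<open>f'\<close> on every arc and respect the capacities.\<close>
  have g_bounds: "min 0 (\<delta> e) \<le> g e" "g e \<le> max 0 (\<delta> e)" for e
    using shrink[where r="\<delta> e" and v="tail G e" and w="head G e"] by (auto simp: g_def pos_def neg_def)
  \<comment> \<open>By \<open>balance\<close>, the slack of \<open>f\<close> does not drop, and that
    of \<open>f'\<close> drops by at most \<open>max 0 (\<sigma> v)\<close>, so not below the
    smaller of the two slacks.\<close>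
  have slack_bounds: "0 \<le> \<rho> v * pos (\<sigma> v)" "\<rho> v * pos (\<sigma> v) \<le> max 0 (\<sigma> v)" for v
    using \<rho> pn mult_left_le_one_le[of "pos (\<sigma> v)" "\<rho> v", OF pn(2) \<rho>] by (auto simp: pos_def)
  have \<sigma>: "\<sigma> v = (net_flow G \<gamma> f' v + (if v \<in> S then x' v else 0))
      - (net_flow G \<gamma> f v + (if v \<in> S then x v else 0))" for v
    by (simp add: \<sigma>_def \<delta>_def[abs_def] Y_def net_flow_diff)
  have tS: "t \<notin> S" using supply_subset by auto
  show thesis
  proof
    show "feasible_flow G t S h \<gamma> (\<lambda>v. x v + d v) (\<lambda>e. f e + g e)"
      unfolding feasible_flow_iff
    proof (intro conjI ballI)
      fix e assume e: "e \<in> arcs G"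
      have "0 \<le> f e + g e \<and> ereal (f e + g e) \<le> h e"
        by (rule between_capacity[of "f e" _ "f' e"])
          (use f f' e g_bounds[of e] in \<open>auto simp: feasible_flow_iff \<delta>_def\<close>)
      then show "0 \<le> f e + g e" "ereal (f e + g e) \<le> h e" by auto
    next
      fix v assume "v \<in> verts G - {t}"
      then have "0 \<le> net_flow G \<gamma> f v + (if v \<in> S then x v else 0)"
        using f feasible_flow_iff by blast
      then show "0 \<le> net_flow G \<gamma> (\<lambda>e. f e + g e) v + (if v \<in> S then x v + d v else 0)"
        using slack_bounds(1)[of v] balance[of v] by (auto simp: net_flow_add D_def)
    qed
    show "feasible_flow G t S h \<gamma> (\<lambda>v. x' v - d v) (\<lambda>e. f' e - g e)"
      unfolding feasible_flow_iff
    proof (intro conjI ballI)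
      fix e assume e: "e \<in> arcs G"
      have "0 \<le> f' e - g e \<and> ereal (f' e - g e) \<le> h e"
        by (rule between_capacity[of "f e" _ "f' e"])
          (use f f' e g_bounds[of e] in \<open>auto simp: feasible_flow_iff \<delta>_def\<close>)
      then show "0 \<le> f' e - g e" "ereal (f' e - g e) \<le> h e" by auto
    next
      fix v assume "v \<in> verts G - {t}"
      then have "0 \<le> net_flow G \<gamma> f v + (if v \<in> S then x v else 0)"
        "0 \<le> net_flow G \<gamma> f' v + (if v \<in> S then x' v else 0)"
        using f f' feasible_flow_iff by blast+
      then show "0 \<le> net_flow G \<gamma> (\<lambda>e. f' e - g e) v + (if v \<in> S then x' v - d v else 0)"
        using slack_bounds(2)[of v] balance[of v] \<sigma>[of v]
        by (auto simp: net_flow_diff D_def)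
    qed
    have a: "net_flow G \<gamma> g t = \<rho> t * pos (\<sigma> t)"
      using balance[of t] tS by (simp add: D_def)
    show "net_flow G \<gamma> (\<lambda>e. f e + g e) t = net_flow G \<gamma> f t + \<rho> t * pos (\<sigma> t)"
      "net_flow G \<gamma> (\<lambda>e. f' e - g e) t = net_flow G \<gamma> f' t - \<rho> t * pos (\<sigma> t)"
      by (simp_all add: net_flow_add net_flow_diff a)
    show "0 \<le> \<rho> t * pos (\<sigma> t)" by (rule slack_bounds)
    show "\<rho> t * pos (\<sigma> t) \<le> max 0 (net_flow G \<gamma> f' t - net_flow G \<gamma> f t)"
      using slack_bounds(2)[of t] \<sigma>[of t] tS by simp
    show "d v = x' v - x v" if "v \<in> P" for v
      using P(2) that by (simp add: d_def pos_def neg_def)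
    show "d v \<le> 0 \<and> min 0 (x' v - x v) \<le> d v" if "v \<notin> P" for v
      using that \<rho> pn mult_left_le_one_le[of "neg (x' v - x v)" "\<rho> v", OF pn(3) \<rho>]
      by (auto simp: d_def neg_def)
  qed
qed

section \<open>Projections of polyhedra\<close>

text \<open>Fourier--Motzkin elimination of the variables \<open>x\<close>.\<close>

lemma closed_projection_halfspaces:
  fixes C :: "('p::real_inner \<times> ('i \<Rightarrow> real) \<times> real) set"
  assumes "finite I" "finite C"
  shows "closed {p. \<exists>x. \<forall>(w, k, r)\<in>C. w \<bullet> p + (\<Sum>i\<in>I. k i * x i) \<le> r}"
  using assms
proof (induction I arbitrary: C rule: finite_induct)
  case empty
  have "{p. \<exists>x :: 'i \<Rightarrow> real. \<forall>(w, k, r)\<in>C. w \<bullet> p + (\<Sum>i\<in>{}. k i * x i) \<le> r}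
      = (\<Inter>(w, k, r)\<in>C. {p. w \<bullet> p \<le> r})"
    by auto
  then show ?case by (auto intro!: closed_INT closed_halfspace_le)
next
  case (insert j I)
  define Z where "Z = {(w, k, r)\<in>C. k j = 0}"
  define U where "U = {(w, k, r)\<in>C. k j > 0}"
  define L where "L = {(w, k, r)\<in>C. k j < 0}"
  \<comment> \<open>Adds \<open>k j\<close> times a lower bound on \<open>x j\<close> to
    \<open>- k' j\<close> times an upper bound; both multipliers are positive, and the coefficients
    of \<open>x j\<close> cancel.\<close>
  define comb where "comb a b = (case (a, b) of ((w, k, r), (w', k', r')) \<Rightarrow>
      (k j *\<^sub>R w' - k' j *\<^sub>R w, \<lambda>i. k j * k' i - k' j * k i, k j * r' - k' j * r))"
    for a b :: "'p \<times> ('i \<Rightarrow> real) \<times> real"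
  define C' where "C' = Z \<union> (\<lambda>(a, b). comb a b) ` (U \<times> L)"
  have fin: "finite Z" "finite U" "finite L"
    using insert.prems by (auto simp: Z_def U_def L_def intro: finite_subset[of _ C])
  have C: "C = Z \<union> U \<union> L"
    by (auto simp: Z_def U_def L_def)
  let ?v = "\<lambda>p x w k r. r - w \<bullet> p - (\<Sum>i\<in>I. k i * x i)"
  have sum_ins: "(\<Sum>i\<in>insert j I. k i * x i) = k j * x j + (\<Sum>i\<in>I. k i * x i)" for k x :: "'i \<Rightarrow> real"
    using insert.hyps by simp
  have sum_comb: "(\<Sum>i\<in>I. (a * k' i - b * k i) * x i) = a * (\<Sum>i\<in>I. k' i * x i) - b * (\<Sum>i\<in>I. k i * x i)"
    for a b and k k' x :: "'i \<Rightarrow> real"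
    by (simp add: left_diff_distrib sum_subtractf sum_distrib_left mult.assoc)
  have combine: "a * W' - c * W + (a * A' - c * A) \<le> a * r' - c * r"
    if "a * (c * x) \<le> a * (r' - W' - A')" "(- c) * (a * x) \<le> (- c) * (r - W - A)"
    for a c x r r' W W' A A' :: real
    using that by (simp add: algebra_simps)
  have "(\<exists>x. \<forall>(w, k, r)\<in>C. w \<bullet> p + (\<Sum>i\<in>insert j I. k i * x i) \<le> r) \<longleftrightarrow>
        (\<exists>x. \<forall>(w, k, r)\<in>C'. w \<bullet> p + (\<Sum>i\<in>I. k i * x i) \<le> r)" for p
  proof
    assume "\<exists>x. \<forall>(w, k, r)\<in>C. w \<bullet> p + (\<Sum>i\<in>insert j I. k i * x i) \<le> r"
    then obtain x where x: "k j * x j \<le> ?v p x w k r" if "(w, k, r) \<in> C" for w k r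
      unfolding sum_ins by (fastforce simp: algebra_simps)
    have "w \<bullet> p + (\<Sum>i\<in>I. k i * x i) \<le> r" if "(w, k, r) \<in> Z" for w k r
      using x[of w k r] that by (auto simp: Z_def)
    moreover have "(k j *\<^sub>R w' - k' j *\<^sub>R w) \<bullet> p + (\<Sum>i\<in>I. (k j * k' i - k' j * k i) * x i)
        \<le> k j * r' - k' j * r"
      if "(w, k, r) \<in> U" "(w', k', r') \<in> L" for w k r w' k' r'
    proof -
      have "k j * (k' j * x j) \<le> k j * ?v p x w' k' r'" "(- k' j) * (k j * x j) \<le> (- k' j) * ?v p x w k r"
        using that x by (auto simp: U_def L_def intro!: mult_left_mono)
      then show ?thesis
        unfolding sum_comb inner_diff_left inner_scaleR_left by (rule combine)
    qed
    ultimately show "\<exists>x. \<forall>(w, k, r)\<in>C'. w \<bullet> p + (\<Sum>i\<in>I. k i * x i) \<le> r"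
      by (intro exI[of _ x]) (auto simp: C'_def comb_def)
  next
    assume "\<exists>x. \<forall>(w, k, r)\<in>C'. w \<bullet> p + (\<Sum>i\<in>I. k i * x i) \<le> r"
    then obtain x where x: "w \<bullet> p + (\<Sum>i\<in>I. k i * x i) \<le> r" if "(w, k, r) \<in> C'" for w k r
      by fastforce
    \<comment> \<open>The bound on \<open>x j\<close> that a constraint imposes once the other
      variables are fixed: from above for \<open>U\<close>, from below for \<open>L\<close>.\<close>
    define b where "b = (\<lambda>(w, k, r). ?v p x w k r / k j)"
    have le: "b l \<le> b u" if "u \<in> U" "l \<in> L" for u l
    proof -
      obtain w k r w' k' r' where ul: "u = (w, k, r)" "l = (w', k', r')"
        by (metis prod_cases3)
      have kj: "0 < k j" "k' j < 0"
        using that by (auto simp: ul U_def L_def)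
      have "(k j *\<^sub>R w' - k' j *\<^sub>R w, \<lambda>i. k j * k' i - k' j * k i, k j * r' - k' j * r) \<in> C'"
        using that unfolding C'_def ul by (force simp: comb_def)
      from x[OF this] have "k' j * ?v p x w k r \<le> k j * ?v p x w' k' r'"
        unfolding sum_comb by (simp add: inner_simps algebra_simps)
      then show ?thesis
        using kj by (simp add: b_def ul field_simps)
    qed
    \<comment> \<open>The greatest lower bound constraint serves as \<open>s\<close>. Without lower
      bounds the least upper bound does, and the inserted 0 makes \<open>Min\<close> meaningful when
      \<open>U\<close> is empty too.\<close>
    have "\<exists>s. (\<forall>u\<in>U. s \<le> b u) \<and> (\<forall>l\<in>L. b l \<le> s)"
    proof (cases "L = {}")
      case True
      then show ?thesis
        using fin by (intro exI[of _ "Min (insert 0 (b ` U))"]) auto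
    next
      case False
      then show ?thesis
        using fin le by (intro exI[of _ "Max (b ` L)"]) auto
    qed
    then obtain s where s: "\<And>u. u \<in> U \<Longrightarrow> s \<le> b u" "\<And>l. l \<in> L \<Longrightarrow> b l \<le> s"
      by blast
    have upd: "(\<Sum>i\<in>I. k i * (x(j := s)) i) = (\<Sum>i\<in>I. k i * x i)" for k
      using insert.hyps by (intro sum.cong) auto
    have "w \<bullet> p + (\<Sum>i\<in>insert j I. k i * (x(j := s)) i) \<le> r" if c: "(w, k, r) \<in> C" for w k r
    proof -
      have "k j * s \<le> ?v p x w k r"
        using c unfolding C
      proof (elim UnE)
        assume "(w, k, r) \<in> Z"
        then show ?thesis using x[of w k r] by (auto simp: C'_def Z_def)
      next
        assume u: "(w, k, r) \<in> U"
        then have "0 < k j" by (simp add: U_def)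
        with s(1)[OF u] show ?thesis by (simp add: b_def field_simps)
      next
        assume l: "(w, k, r) \<in> L"
        then have "k j < 0" by (simp add: L_def)
        with s(2)[OF l] show ?thesis by (simp add: b_def field_simps)
      qed
      then show ?thesis unfolding sum_ins upd by simp
    qed
    then show "\<exists>x. \<forall>(w, k, r)\<in>C. w \<bullet> p + (\<Sum>i\<in>insert j I. k i * x i) \<le> r"
      by blast
  qed
  moreover have "finite C'"
    using fin by (simp add: C'_def)
  ultimately show ?case
    using insert.IH[of C'] by simp
qed

text \<open>Here \<open>p\<close> holds the coordinates that survive projection and \<open>x\<close>
  those to be eliminated. The existential over coefficients lets the closure rules below recognize
  flow constraints by their syntax.\<close>

definition affine_form :: "'i set \<Rightarrow> ('p::real_inner \<Rightarrow> ('i \<Rightarrow> real) \<Rightarrow> real) \<Rightarrow> bool" where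
  "affine_form I \<phi> \<longleftrightarrow> (\<exists>w k r. \<forall>p x. \<phi> p x = w \<bullet> p + (\<Sum>i\<in>I. k i * x i) + r)"

lemma affine_form_inner: "affine_form I (\<lambda>p x. w \<bullet> p)"
  unfolding affine_form_def by (intro exI[of _ w] exI[of _ "\<lambda>_. 0"] exI[of _ 0]) simp

lemma affine_form_const: "affine_form I (\<lambda>p x. r)"
  unfolding affine_form_def by (intro exI[of _ 0] exI[of _ "\<lambda>_. 0"] exI[of _ r]) simp

lemma affine_form_coord:
  assumes "finite I" "i \<in> I"
  shows "affine_form I (\<lambda>p x. x i)"
  unfolding affine_form_def
  by (intro exI[of _ 0] exI[of _ "\<lambda>j. if j = i then 1 else 0"] exI[of _ 0])
    (use assms in \<open>simp add: if_distrib[of "\<lambda>c. c * _"] cong: if_cong\<close>)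

lemma affine_form_add:
  assumes "affine_form I \<phi>" "affine_form I \<psi>"
  shows "affine_form I (\<lambda>p x. \<phi> p x + \<psi> p x)"
proof -
  obtain w k r w' k' r' where "\<And>p x. \<phi> p x = w \<bullet> p + (\<Sum>i\<in>I. k i * x i) + r"
    "\<And>p x. \<psi> p x = w' \<bullet> p + (\<Sum>i\<in>I. k' i * x i) + r'"
    using assms unfolding affine_form_def by meson
  then show ?thesis unfolding affine_form_def
    by (intro exI[of _ "w + w'"] exI[of _ "\<lambda>i. k i + k' i"] exI[of _ "r + r'"])
      (simp add: inner_simps sum.distrib algebra_simps)
qed

lemma affine_form_cmult:
  assumes "affine_form I \<phi>"
  shows "affine_form I (\<lambda>p x. c * \<phi> p x)"
proof -
  obtain w k r where "\<And>p x. \<phi> p x = w \<bullet> p + (\<Sum>i\<in>I. k i * x i) + r"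
    using assms unfolding affine_form_def by meson
  then show ?thesis unfolding affine_form_def
    by (intro exI[of _ "c *\<^sub>R w"] exI[of _ "\<lambda>i. c * k i"] exI[of _ "c * r"])
      (simp add: sum_distrib_left algebra_simps)
qed

lemma affine_form_minus: "affine_form I \<phi> \<Longrightarrow> affine_form I (\<lambda>p x. - \<phi> p x)"
  using affine_form_cmult[of I \<phi> "-1"] by simp

lemma affine_form_diff:
  "affine_form I \<phi> \<Longrightarrow> affine_form I \<psi> \<Longrightarrow> affine_form I (\<lambda>p x. \<phi> p x - \<psi> p x)"
  using affine_form_add[OF _ affine_form_minus, of I \<phi> \<psi>] by simp

lemma affine_form_sum:
  "(\<And>a. a \<in> A \<Longrightarrow> affine_form I (\<phi> a)) \<Longrightarrow> affine_form I (\<lambda>p x. \<Sum>a\<in>A. \<phi> a p x)"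
  by (induction A rule: infinite_finite_induct) (simp_all add: affine_form_const affine_form_add)

lemma closed_projection_affine_form:
  fixes \<Phi> :: "('p::real_inner \<Rightarrow> ('i \<Rightarrow> real) \<Rightarrow> real) set"
  assumes "finite I" "finite \<Phi>" "\<And>\<phi>. \<phi> \<in> \<Phi> \<Longrightarrow> affine_form I \<phi>"
  shows "closed {p. \<exists>x. \<forall>\<phi>\<in>\<Phi>. 0 \<le> \<phi> p x}"
proof -
  have "\<exists>w k r. \<forall>p x. - \<phi> p x = w \<bullet> p + (\<Sum>i\<in>I. k i * x i) + r" if "\<phi> \<in> \<Phi>" for \<phi>
    using affine_form_minus[OF assms(3)[OF that]] unfolding affine_form_def .
  then obtain w k r where wkr:
    "\<And>\<phi> p x. \<phi> \<in> \<Phi> \<Longrightarrow> - \<phi> p x = w \<phi> \<bullet> p + (\<Sum>i\<in>I. k \<phi> i * x i) + r \<phi>"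
    by metis
  have "0 \<le> \<phi> p x \<longleftrightarrow> w \<phi> \<bullet> p + (\<Sum>i\<in>I. k \<phi> i * x i) \<le> - r \<phi>" if "\<phi> \<in> \<Phi>" for \<phi> p x
    using wkr[OF that, of p x] by linarith
  then have "{p. \<exists>x. \<forall>\<phi>\<in>\<Phi>. 0 \<le> \<phi> p x} =
      {p. \<exists>x. \<forall>(w, k, r)\<in>(\<lambda>\<phi>. (w \<phi>, k \<phi>, - r \<phi>)) ` \<Phi>. w \<bullet> p + (\<Sum>i\<in>I. k i * x i) \<le> r}"
    by simp
  then show ?thesis
    using closed_projection_halfspaces[OF assms(1), of "(\<lambda>\<phi>. (w \<phi>, k \<phi>, - r \<phi>)) ` \<Phi>"] assms(2) by simp
qed

section \<open>Existence of Gale demands\<close>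

text \<open>\<open>K\<close> stands for attainable pairs of flow value and cost. The price domain
  bounds the objective for one budget \<open>b0\<close>, possibly different from \<open>b\<close>.
  Star-shapedness turns that bound into linear growth of the value in the cost; the logarithm then
  grows more slowly than the cost for every \<open>b\<close>, so the search reduces to a compact
  set.\<close>

lemma gale_maximum_exists:
  fixes K :: "(real \<times> real) set"
  assumes "closed K"
    and star: "\<And>z c r. (z, c) \<in> K \<Longrightarrow> 0 \<le> r \<Longrightarrow> r \<le> 1 \<Longrightarrow> (r * z, r * c) \<in> K"
    and cost: "\<And>z c. (z, c) \<in> K \<Longrightarrow> 0 \<le> c"
    and K1: "(z1, c1) \<in> K" "0 < z1"
    and b0: "0 < b0" and M: "\<And>z c. (z, c) \<in> K \<Longrightarrow> 0 < z \<Longrightarrow> b0 * ln z - c \<le> M"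
    and b: "0 < b"
  obtains z c where "(z, c) \<in> K" "0 < z"
    "\<And>z' c'. (z', c') \<in> K \<Longrightarrow> 0 < z' \<Longrightarrow> b * ln z' - c' \<le> b * ln z - c"
proof -
  define A where "A = exp ((M + 1) / b0)"
  have A: "0 < A" by (simp add: A_def)
  have low: "z \<le> A" if K: "(z, c) \<in> K" and z: "0 < z" and c: "c \<le> 1" for z c
  proof -
    have "b0 * ln z \<le> M + 1" using M[OF K z] c by simp
    then have "ln z \<le> (M + 1) / b0" using b0 by (simp add: field_simps)
    then have "exp (ln z) \<le> A" unfolding A_def by simp
    then show ?thesis using z by simp
  qed
  have lin: "z \<le> A * (1 + c)" if K: "(z, c) \<in> K" and z: "0 < z" for z c
  proof (cases "c \<le> 1")
    case True
    then show ?thesis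
      using low[OF K z True] cost[OF K] A by (simp add: distrib_left add_increasing2)
  next
    case False
    \<comment> \<open>Shrinking to cost 1 reduces to the case \<open>low\<close>.\<close>
    then have "((1 / c) * z, (1 / c) * c) \<in> K"
      by (intro star K) auto
    then have "(1 / c) * z \<le> A"
      by (rule low) (use z False in auto)
    then show ?thesis using False A by (simp add: field_simps)
  qed
  define F where "F p = b * ln (fst p) - snd p" for p :: "real \<times> real"
  define v where "v = F (z1, c1)"
  \<comment> \<open>Obtained from \<open>ln w \<le> w - 1\<close> at
    \<open>w = (1 + c) / (2 * b)\<close>: then \<open>b * ln z\<close> grows at most like
    \<open>c / 2\<close>, and half of the cost remains to bound \<open>c\<close>. A term
    \<open>- b\<close> is dropped.\<close>
  define C where "C = 2 * (b * ln A + 1 / 2 + b * ln (2 * b) - v)"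
  have cle: "c \<le> C" if K: "(z, c) \<in> K" and z: "0 < z" and ge: "v \<le> F (z, c)" for z c
  proof -
    have c: "0 \<le> c" by (rule cost[OF K])
    have "ln z \<le> ln (A * (1 + c))" using lin[OF K z] z by simp
    also have "\<dots> = ln A + ln ((1 + c) / (2 * b)) + ln (2 * b)"
      using A b c by (simp add: ln_mult ln_div)
    also have "\<dots> \<le> ln A + ((1 + c) / (2 * b) - 1) + ln (2 * b)"
      using b c by (simp add: ln_le_minus_one)
    finally have "b * ln z \<le> b * (ln A + ((1 + c) / (2 * b) - 1) + ln (2 * b))"
      using b by simp
    also have "\<dots> = b * ln A + (1 + c) / 2 - b + b * ln (2 * b)"
      using b by (simp add: field_simps)
    finally have "b * ln z \<le> b * ln A + (1 + c) / 2 - b + b * ln (2 * b)" .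
    moreover have "v \<le> b * ln z - c" using ge by (simp add: F_def)
    ultimately show ?thesis unfolding C_def using b by argo
  qed
  \<comment> \<open>Contains every point of \<open>K\<close> with positive value that is at least as
    good as \<open>(z1, c1)\<close>. The lower end \<open>exp (v / b)\<close> keeps \<open>z\<close>
    away from 0, where \<open>ln\<close> is not continuous.\<close>
  define Q where "Q = K \<inter> ({exp (v / b)..A * (1 + C)} \<times> {0..C})"
  have inQ: "(z, c) \<in> Q" if K: "(z, c) \<in> K" and z: "0 < z" and ge: "v \<le> F (z, c)" for z c
  proof -
    have c: "0 \<le> c" "c \<le> C" using cost[OF K] cle[OF that] by auto
    have "v \<le> b * ln z" using ge c by (simp add: F_def)
    then have "v / b \<le> ln z" using b by (simp add: field_simps)
    then have "exp (v / b) \<le> z" using z by (simp add: ln_ge_iff)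
    moreover have "A * (1 + c) \<le> A * (1 + C)" using A c by simp
    ultimately show ?thesis using lin[OF K z] K c by (auto simp: Q_def)
  qed
  have posQ: "0 < fst p" if "p \<in> Q" for p
    using that less_le_trans[OF exp_gt_zero] by (fastforce simp: Q_def)
  have "compact Q"
    unfolding Q_def using \<open>closed K\<close> by (intro closed_Int_compact compact_Times compact_Icc)
  moreover have "(z1, c1) \<in> Q" using K1 by (intro inQ) (auto simp: v_def)
  moreover have "continuous_on Q F"
    unfolding F_def using posQ by (intro continuous_intros) (auto dest: posQ)
  ultimately obtain p where p: "p \<in> Q" "\<And>p'. p' \<in> Q \<Longrightarrow> F p' \<le> F p"
    using continuous_attains_sup[of Q F] by blast
  show thesis
  proof (rule that[of "fst p" "snd p"])
    show "(fst p, snd p) \<in> K" "0 < fst p" using p posQ by (auto simp: Q_def)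
    fix z' c' assume K': "(z', c') \<in> K" "0 < z'"
    have "F (z', c') \<le> F p"
    proof (cases "v \<le> F (z', c')")
      case True
      then show ?thesis using inQ K' p by blast
    next
      case False
      then show ?thesis using p(2)[OF \<open>(z1, c1) \<in> Q\<close>] by (simp add: v_def)
    qed
    then show "b * ln z' - c' \<le> b * ln (fst p) - snd p" by (simp add: F_def)
  qed
qed

text \<open>A bundle of positive utility has a finite objective, so no maximizer has objective minus
  infinity, and the comparison becomes one of real numbers.\<close>

lemma gale_demand_iff:
  assumes "\<And>x. 0 \<le> x \<Longrightarrow> 0 \<le> u x" "\<exists>x\<ge>0. 0 < u x"
  shows "y \<in> gale_demand u q b \<longleftrightarrow> 0 \<le> y \<and> 0 < u y \<and>
    (\<forall>y'\<ge>0. 0 < u y' \<longrightarrow> b * ln (u y') - q \<bullet> y' \<le> b * ln (u y) - q \<bullet> y)"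
proof
  assume "y \<in> gale_demand u q b"
  then have y: "0 \<le> y" and max: "\<And>y'. 0 \<le> y' \<Longrightarrow> gale_objective u q b y' \<le> gale_objective u q b y"
    by (auto simp: gale_demand_def is_arg_max_def not_less)
  obtain x where "0 \<le> x" "0 < u x" using assms(2) by blast
  with max[of x] have "u y \<noteq> 0" by (auto simp: gale_objective_def)
  with y assms(1)[OF y] have uy: "0 < u y" by simp
  moreover have "b * ln (u y') - q \<bullet> y' \<le> b * ln (u y) - q \<bullet> y" if "0 \<le> y'" "0 < u y'" for y'
    using max[OF that(1)] that uy by (simp add: gale_objective_def)
  ultimately show "0 \<le> y \<and> 0 < u y \<and>
    (\<forall>y'\<ge>0. 0 < u y' \<longrightarrow> b * ln (u y') - q \<bullet> y' \<le> b * ln (u y) - q \<bullet> y)"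
    using y by blast
next
  assume y: "0 \<le> y \<and> 0 < u y \<and>
    (\<forall>y'\<ge>0. 0 < u y' \<longrightarrow> b * ln (u y') - q \<bullet> y' \<le> b * ln (u y) - q \<bullet> y)"
  have "gale_objective u q b y' \<le> gale_objective u q b y" if "0 \<le> y'" for y'
    using y that assms(1)[OF that] by (auto simp: gale_objective_def)
  then show "y \<in> gale_demand u q b"
    using y by (auto simp: gale_demand_def is_arg_max_def not_less)
qed

lemma price_domain_bound:
  assumes "q \<in> price_domain u"
  obtains b M where "0 < b" "\<And>y. 0 \<le> y \<Longrightarrow> 0 < u y \<Longrightarrow> b * ln (u y) - q \<bullet> y \<le> M"
proof -
  from assms obtain b where b: "0 < b" "(SUP y\<in>{y. 0 \<le> y}. gale_objective u q b y) < \<infinity>"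
    by (auto simp: price_domain_def)
  then obtain n :: nat where n: "(SUP y\<in>{y. 0 \<le> y}. gale_objective u q b y) < ereal (real n)"
    using less_PInf_Ex_of_nat by auto
  have "b * ln (u y) - q \<bullet> y \<le> real n" if "0 \<le> y" "0 < u y" for y
  proof -
    have "gale_objective u q b y \<le> (SUP y\<in>{y. 0 \<le> y}. gale_objective u q b y)"
      using that by (intro SUP_upper) auto
    then have "gale_objective u q b y \<le> ereal (real n)" using n by order
    then show ?thesis using that by (simp add: gale_objective_def)
  qed
  then show thesis using b(1) that by blast
qed

section \<open>Flows as a linear system\<close>

lemma feasible_flow_cong:
  "(\<And>v. v \<in> S \<Longrightarrow> x v = x' v) \<Longrightarrow> feasible_flow G t S h \<gamma> x f = feasible_flow G t S h \<gamma> x' f"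
  by (simp add: feasible_flow_def)

text \<open>Provides the star-shapedness asked for by \<open>gale_maximum_exists\<close>;
  \<open>r \<le> 1\<close> is what preserves the capacities.\<close>

lemma (in generalized_flow_instance) feasible_flow_scale:
  assumes f: "feasible_flow G t S h \<gamma> x f" and r: "0 \<le> r" "r \<le> 1"
  shows "feasible_flow G t S h \<gamma> (\<lambda>v. r * x v) (\<lambda>e. r * f e)"
  unfolding feasible_flow_def
proof (intro conjI ballI)
  fix e assume "e \<in> arcs G"
  then have e: "0 \<le> f e" "ereal (f e) \<le> h e" using f by (auto simp: feasible_flow_def)
  show "0 \<le> r * f e" using e r by simp
  have "ereal (r * f e) \<le> ereal (f e)" using e r by (simp add: mult_left_le_one_le)
  then show "ereal (r * f e) \<le> h e" using e by order
next
  fix v assume "v \<in> S"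
  then have "- x v \<le> net_flow G \<gamma> f v" using f by (auto simp: feasible_flow_def)
  then show "- (r * x v) \<le> net_flow G \<gamma> (\<lambda>e. r * f e) v"
    using mult_left_mono[OF _ r(1)] by (fastforce simp: net_flow_cmult)
next
  fix v assume "v \<in> verts G - (S \<union> {t})"
  then have "0 \<le> net_flow G \<gamma> f v" using f by (auto simp: feasible_flow_def)
  then show "0 \<le> net_flow G \<gamma> (\<lambda>e. r * f e) v"
    using r by (simp add: net_flow_cmult)
qed

text \<open>Flows and supplies may be unbounded, so compactness does not give closedness. All
  conditions are linear in \<open>f\<close>, \<open>y\<close> and \<open>p\<close>, and eliminating
  \<open>f\<close> and \<open>y\<close> leaves finitely many closed half-spaces.\<close>

lemma (in generalized_flow_instance) closed_value_cost:
  fixes s :: "'m::finite \<Rightarrow> 'v" and q :: "real ^ 'm"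
  shows "closed {p. \<exists>f y. 0 \<le> y \<and> feasible_flow G t S h \<gamma> (\<lambda>v. y $ inv s v) f \<and>
    net_flow G \<gamma> f t = fst p \<and> q \<bullet> y = snd p}"
proof -
  define I where "I = Inl ` arcs G \<union> range (Inr :: 'm \<Rightarrow> 'e + 'm)"
  define net where "net v x = net_flow G \<gamma> (\<lambda>e. x (Inl e)) v" for v and x :: "'e + 'm \<Rightarrow> real"
  define cost where "cost x = (\<Sum>j\<in>UNIV. q $ j * x (Inr j))" for x :: "'e + 'm \<Rightarrow> real"
  \<comment> \<open>\<open>Inl e\<close> is the flow on an arc and \<open>Inr j\<close> the supply
    of a good. Infinite capacities give no constraint, and each of the two equations becomes a pair
    of inequalities.\<close>
  define \<Phi> :: "(real \<times> real \<Rightarrow> ('e + 'm \<Rightarrow> real) \<Rightarrow> real) set" where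
    "\<Phi> = (\<lambda>e p x. x (Inl e)) ` arcs G \<union>
      (\<lambda>e p x. real_of_ereal (h e) - x (Inl e)) ` {e \<in> arcs G. h e \<noteq> \<infinity>} \<union>
      range (\<lambda>j p x. x (Inr j)) \<union>
      (\<lambda>v p x. net v x + (if v \<in> S then x (Inr (inv s v)) else 0)) ` (verts G - {t}) \<union>
      {\<lambda>p x. net t x - (1, 0) \<bullet> p, \<lambda>p x. (1, 0) \<bullet> p - net t x,
       \<lambda>p x. cost x - (0, 1) \<bullet> p, \<lambda>p x. (0, 1) \<bullet> p - cost x}"
  have I: "finite I" by (simp add: I_def)
  have coord: "affine_form I (\<lambda>(p :: real \<times> real) x. x (Inl e))" if "e \<in> arcs G" for e
    using that I by (intro affine_form_coord) (auto simp: I_def)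
  have coord': "affine_form I (\<lambda>(p :: real \<times> real) x. x (Inr j))" for j
    using I by (intro affine_form_coord) (auto simp: I_def)
  have net: "affine_form I (\<lambda>(p :: real \<times> real) x. net v x)" for v
    unfolding net_def net_flow_def
    by (intro affine_form_diff affine_form_sum affine_form_cmult coord) auto
  have ite: "affine_form I (\<lambda>(p :: real \<times> real) x. if v \<in> S then x (Inr (inv s v)) else 0)" for v
    using coord' affine_form_const by (cases "v \<in> S") auto
  have cost: "affine_form I (\<lambda>(p :: real \<times> real) x. cost x)"
    unfolding cost_def by (intro affine_form_sum affine_form_cmult coord')
  have "\<forall>\<phi>\<in>\<Phi>. affine_form I \<phi>"
    unfolding \<Phi>_def ball_Un ball_simps
    by (intro conjI ballI TrueI affine_form_diff affine_form_add net ite cost coord coord'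
        affine_form_inner affine_form_const)
      (auto intro: affine_form_diff coord coord' affine_form_const)
  moreover have "finite \<Phi>" by (simp add: \<Phi>_def)
  ultimately have "closed {p. \<exists>x. \<forall>\<phi>\<in>\<Phi>. 0 \<le> \<phi> p x}"
    by (intro closed_projection_affine_form[OF I]) auto
  also have "{p. \<exists>x. \<forall>\<phi>\<in>\<Phi>. 0 \<le> \<phi> p x} = {p. \<exists>f y. 0 \<le> y \<and>
      feasible_flow G t S h \<gamma> (\<lambda>v. y $ inv s v) f \<and> net_flow G \<gamma> f t = fst p \<and> q \<bullet> y = snd p}"
    (is "?A = ?B")
  proof -
    have cap: "ereal r \<le> h e \<longleftrightarrow> h e = \<infinity> \<or> r \<le> real_of_ereal (h e)" if "e \<in> arcs G" for e r
      using capacity_nonneg[OF that] by (cases "h e") auto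
    have \<Phi>: "(\<forall>\<phi>\<in>\<Phi>. 0 \<le> \<phi> p x) \<longleftrightarrow> 0 \<le> (\<chi> j. x (Inr j)) \<and>
        feasible_flow G t S h \<gamma> (\<lambda>v. (\<chi> j. x (Inr j)) $ inv s v) (\<lambda>e. x (Inl e)) \<and>
        net_flow G \<gamma> (\<lambda>e. x (Inl e)) t = fst p \<and> q \<bullet> (\<chi> j. x (Inr j)) = snd p" for p x
    proof -
      have "(\<forall>\<phi>\<in>\<Phi>. 0 \<le> \<phi> p x) \<longleftrightarrow> (\<forall>e\<in>arcs G. 0 \<le> x (Inl e)) \<and>
          (\<forall>e\<in>arcs G. h e = \<infinity> \<or> x (Inl e) \<le> real_of_ereal (h e)) \<and> (\<forall>j. 0 \<le> x (Inr j)) \<and>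
          (\<forall>v\<in>verts G - {t}. 0 \<le> net v x + (if v \<in> S then x (Inr (inv s v)) else 0)) \<and>
          net t x = fst p \<and> cost x = snd p"
        unfolding \<Phi>_def ball_Un ball_simps by (cases p) (simp, blast intro: order_antisym)
      also have "(\<forall>e\<in>arcs G. h e = \<infinity> \<or> x (Inl e) \<le> real_of_ereal (h e)) \<longleftrightarrow>
          (\<forall>e\<in>arcs G. ereal (x (Inl e)) \<le> h e)"
        using cap by blast
      finally show ?thesis
        unfolding feasible_flow_iff net_def cost_def by (simp add: less_eq_vec_def inner_vec_def) blast
    qed
    show ?thesis
    proof (intro set_eqI iffI; unfold mem_Collect_eq)
      fix p assume "\<exists>x. \<forall>\<phi>\<in>\<Phi>. 0 \<le> \<phi> p x"
      then show "\<exists>f y. 0 \<le> y \<and> feasible_flow G t S h \<gamma> (\<lambda>v. y $ inv s v) f \<and>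
          net_flow G \<gamma> f t = fst p \<and> q \<bullet> y = snd p"
        unfolding \<Phi> by blast
    next
      fix p assume "\<exists>f y. 0 \<le> y \<and> feasible_flow G t S h \<gamma> (\<lambda>v. y $ inv s v) f \<and>
          net_flow G \<gamma> f t = fst p \<and> q \<bullet> y = snd p"
      then obtain f y where "0 \<le> y" "feasible_flow G t S h \<gamma> (\<lambda>v. y $ inv s v) f"
          "net_flow G \<gamma> f t = fst p" "q \<bullet> y = snd p" by blast
      then show "\<exists>x. \<forall>\<phi>\<in>\<Phi>. 0 \<le> \<phi> p x"
        unfolding \<Phi> by (intro exI[of _ "case_sum f (($) y)"]) simp
    qed
  qed
  finally show ?thesis .
qed

section \<open>Demand monotonicity\<close>

locale network_utility = generalized_flow_instance G t S h \<gamma>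
  for G :: "('v, 'e) pre_digraph" and t S h \<gamma> +
  fixes s :: "'m::finite \<Rightarrow> 'v" and u :: "real ^ 'm \<Rightarrow> real"
  assumes s: "bij_betw s UNIV S"
    and max_flow: "0 \<le> x \<Longrightarrow> is_max_flow_value G t S h \<gamma> (\<lambda>v. x $ inv s v) (u x)"
    and utility_nonneg: "0 \<le> x \<Longrightarrow> 0 \<le> u x"
    and utility_pos: "\<exists>x\<ge>0. 0 < u x"
begin

lemma optimal_flow:
  assumes "0 \<le> x"
  obtains f where "feasible_flow G t S h \<gamma> (\<lambda>v. x $ inv s v) f" "net_flow G \<gamma> f t = u x"
  using max_flow[OF assms] by (auto simp: is_max_flow_value_def)

lemma net_flow_le_utility:
  "0 \<le> x \<Longrightarrow> feasible_flow G t S h \<gamma> (\<lambda>v. x $ inv s v) f \<Longrightarrow> net_flow G \<gamma> f t \<le> u x"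
  using max_flow[of x] by (auto simp: is_max_flow_value_def)

lemma inv_s [simp]: "inv s (s j) = j"
  using s by (simp add: bij_betw_def)

lemma s_inv [simp]: "v \<in> S \<Longrightarrow> s (inv s v) = v"
  using s by (auto simp: bij_betw_def)

lemma demand_iff:
  "y \<in> gale_demand u q b \<longleftrightarrow> 0 \<le> y \<and> 0 < u y \<and>
    (\<forall>y'\<ge>0. 0 < u y' \<longrightarrow> b * ln (u y') - q \<bullet> y' \<le> b * ln (u y) - q \<bullet> y)"
  by (rule gale_demand_iff[OF utility_nonneg utility_pos])

lemma gale_demand_nonempty:
  assumes q: "q \<in> price_domain u" and b: "0 < b"
  obtains y where "y \<in> gale_demand u q b"
proof -
  define K where "K = {p. \<exists>f y. 0 \<le> y \<and> feasible_flow G t S h \<gamma> (\<lambda>v. y $ inv s v) f \<and>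
    net_flow G \<gamma> f t = fst p \<and> q \<bullet> y = snd p}"
  have KI: "(u y, q \<bullet> y) \<in> K" if y: "0 \<le> y" for y
  proof -
    obtain f where "feasible_flow G t S h \<gamma> (\<lambda>v. y $ inv s v) f" "net_flow G \<gamma> f t = u y"
      using optimal_flow[OF y] .
    with y show ?thesis unfolding K_def by auto
  qed
  \<comment> \<open>\<open>K\<close> also contains flows that are not maximum for their supply,
    hence only an inequality between \<open>z\<close> and \<open>u y\<close>.\<close>
  have KE: "\<exists>y\<ge>0. z \<le> u y \<and> c = q \<bullet> y" if "(z, c) \<in> K" for z c
    using that by (auto simp: K_def intro: net_flow_le_utility)
  obtain b0 M where b0: "0 < b0" and M: "\<And>y. 0 \<le> y \<Longrightarrow> 0 < u y \<Longrightarrow> b0 * ln (u y) - q \<bullet> y \<le> M"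
    using price_domain_bound[OF q] by blast
  obtain x where x: "0 \<le> x" "0 < u x" using utility_pos by blast
  have "\<exists>z c. (z, c) \<in> K \<and> 0 < z \<and>
      (\<forall>z' c'. (z', c') \<in> K \<longrightarrow> 0 < z' \<longrightarrow> b * ln z' - c' \<le> b * ln z - c)"
  proof (rule gale_maximum_exists[of K "u x" "q \<bullet> x" b0 M b])
    show "closed K" unfolding K_def by (rule closed_value_cost)
    show "(r * z, r * c) \<in> K" if "(z, c) \<in> K" and r: "0 \<le> r" "r \<le> 1" for z c r
    proof -
      obtain f y where fy: "0 \<le> y" "feasible_flow G t S h \<gamma> (\<lambda>v. y $ inv s v) f"
          "net_flow G \<gamma> f t = z" "q \<bullet> y = c"
        using \<open>(z, c) \<in> K\<close> unfolding K_def by auto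
      have "0 \<le> r *\<^sub>R y" "feasible_flow G t S h \<gamma> (\<lambda>v. (r *\<^sub>R y) $ inv s v) (\<lambda>e. r * f e)"
          "net_flow G \<gamma> (\<lambda>e. r * f e) t = r * z" "q \<bullet> (r *\<^sub>R y) = r * c"
        using fy r feasible_flow_scale[OF fy(2) r]
        by (auto simp: net_flow_cmult less_eq_vec_def)
      then show ?thesis unfolding K_def mem_Collect_eq fst_conv snd_conv by blast
    qed
    have "0 \<le> q" using q by (simp add: price_domain_def)
    then have "0 \<le> q \<bullet> y" if "0 \<le> y" for y
      using that by (auto simp: inner_vec_def less_eq_vec_def intro!: sum_nonneg)
    then show "0 \<le> c" if "(z, c) \<in> K" for z c
      using KE[OF that] by auto
    show "b0 * ln z - c \<le> M" if K: "(z, c) \<in> K" and z: "0 < z" for z c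
    proof -
      obtain y where y: "0 \<le> y" "z \<le> u y" "c = q \<bullet> y" using KE[OF K] by blast
      then have "b0 * ln z \<le> b0 * ln (u y)" using z b0 by simp
      then show ?thesis using M[of y] y z by simp
    qed
  qed (use x KI b b0 in blast)+
  then obtain z c where zc: "(z, c) \<in> K" "0 < z"
      "\<And>z' c'. (z', c') \<in> K \<Longrightarrow> 0 < z' \<Longrightarrow> b * ln z' - c' \<le> b * ln z - c"
    by blast
  obtain y where y: "0 \<le> y" "z \<le> u y" "c = q \<bullet> y" using KE[OF zc(1)] by blast
  \<comment> \<open>Replacing \<open>z\<close> by \<open>u y\<close> at the same cost does not lower
    the objective, so the best pair in \<open>K\<close> yields a best bundle.\<close>
  have "b * ln z \<le> b * ln (u y)" using y zc b by simp
  then have "y \<in> gale_demand u q b"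
    unfolding demand_iff using y zc(2) zc(3)[OF KI] by fastforce
  then show thesis by (rule that)
qed

text \<open>Covers both halves of the substitutes property: \<open>b' = b\<close> gives the first,
  and \<open>q' = q\<close>, where every good has an unchanged price, gives the second.\<close>

lemma gale_demand_monotone:
  assumes b: "0 < b'" "b' \<le> b" and q': "q' \<in> price_domain u" and le: "q' \<le> q"
    and y: "y \<in> gale_demand u q b"
  shows "\<exists>y'\<in>gale_demand u q' b'. \<forall>j. q' $ j = q $ j \<longrightarrow> y' $ j \<le> y $ j"
proof -
  obtain y' where y': "y' \<in> gale_demand u q' b'"
    using gale_demand_nonempty[OF q' b(1)] .
  have y0: "0 \<le> y" "0 < u y" and opt: "\<And>w. 0 \<le> w \<Longrightarrow> 0 < u w \<Longrightarrow> b * ln (u w) - q \<bullet> w \<le> b * ln (u y) - q \<bullet> y"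
    using y unfolding demand_iff by auto
  have y'0: "0 \<le> y'" "0 < u y'"
    and opt': "\<And>w. 0 \<le> w \<Longrightarrow> 0 < u w \<Longrightarrow> b' * ln (u w) - q' \<bullet> w \<le> b' * ln (u y') - q' \<bullet> y'"
    using y' unfolding demand_iff by auto
  obtain f where f: "feasible_flow G t S h \<gamma> (\<lambda>v. y $ inv s v) f" "net_flow G \<gamma> f t = u y"
    using optimal_flow[OF y0(1)] .
  obtain f' where f': "feasible_flow G t S h \<gamma> (\<lambda>v. y' $ inv s v) f'" "net_flow G \<gamma> f' t = u y'"
    using optimal_flow[OF y'0(1)] .
  define P where "P = s ` {j. q' $ j = q $ j \<and> y $ j < y' $ j}"
  have sP: "s j \<in> P \<longleftrightarrow> q' $ j = q $ j \<and> y $ j < y' $ j" for j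
    using s by (simp add: P_def inj_image_mem_iff bij_betw_def)
  have PS: "P \<subseteq> S" using s by (auto simp: P_def bij_betw_def)
  have Ple: "\<forall>v\<in>P. y $ inv s v \<le> y' $ inv s v"
    by (auto simp: P_def)
  obtain d g a where ex:
    "feasible_flow G t S h \<gamma> (\<lambda>v. y $ inv s v + d v) (\<lambda>e. f e + g e)"
    "feasible_flow G t S h \<gamma> (\<lambda>v. y' $ inv s v - d v) (\<lambda>e. f' e - g e)"
    "net_flow G \<gamma> (\<lambda>e. f e + g e) t = u y + a"
    "net_flow G \<gamma> (\<lambda>e. f' e - g e) t = u y' - a"
    "0 \<le> a" "a \<le> max 0 (u y' - u y)"
    "\<And>v. v \<in> P \<Longrightarrow> d v = y' $ inv s v - y $ inv s v"
    "\<And>v. v \<notin> P \<Longrightarrow> d v \<le> 0 \<and> min 0 (y' $ inv s v - y $ inv s v) \<le> d v"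
    by (rule flow_exchange[OF f(1) f'(1) PS Ple, unfolded f(2) f'(2)]) (rule that)
  define D where "D = (\<chi> j. d (s j))"
  have DP: "D $ j = y' $ j - y $ j" if "q' $ j = q $ j" "y $ j < y' $ j" for j
    using ex(7)[of "s j"] that by (simp add: D_def sP)
  have DN: "D $ j \<le> 0" "min 0 (y' $ j - y $ j) \<le> D $ j" if "\<not> (q' $ j = q $ j \<and> y $ j < y' $ j)" for j
    using ex(8)[of "s j"] that by (auto simp: D_def sP)
  have comp: "0 \<le> y $ j" "0 \<le> y' $ j" "q' $ j \<le> q $ j" for j
    using y0 y'0 le by (auto simp: less_eq_vec_def)
  have yD: "0 \<le> y + D"
    unfolding less_eq_vec_def
  proof
    fix j show "0 $ j \<le> (y + D) $ j"
      using DP[of j] DN[of j] comp[of j] by (cases "q' $ j = q $ j \<and> y $ j < y' $ j") auto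
  qed
  have y'D: "0 \<le> y' - D"
    unfolding less_eq_vec_def
  proof
    fix j show "0 $ j \<le> (y' - D) $ j"
      using DP[of j] DN[of j] comp[of j] by (cases "q' $ j = q $ j \<and> y $ j < y' $ j") auto
  qed
  have "u y + a \<le> u (y + D)"
    unfolding ex(3)[symmetric]
    by (rule net_flow_le_utility[OF yD]) (use ex(1) in \<open>simp add: D_def cong: feasible_flow_cong\<close>)
  moreover have "u y' - a \<le> u (y' - D)"
    unfolding ex(4)[symmetric]
    by (rule net_flow_le_utility[OF y'D]) (use ex(2) in \<open>simp add: D_def cong: feasible_flow_cong\<close>)
  \<comment> \<open>As \<open>a \<le> max 0 (u y' - u y)\<close>, the value \<open>u y' - a\<close>
    is at least the smaller of \<open>u y\<close> and \<open>u y'\<close>.\<close>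
  moreover have a: "0 < u y + a" "0 < u y' - a"
    using ex(5,6) y0 y'0 by auto
  ultimately have u_pos: "0 < u (y + D)" "0 < u (y' - D)"
    and ln_ge: "ln (u y + a) \<le> ln (u (y + D))" "ln (u y' - a) \<le> ln (u (y' - D))"
    by auto
  \<comment> \<open>The gain in the logarithm is nonnegative because \<open>0 \<le> a\<close>, so
    the smaller budget may replace the larger; optimality of \<open>y\<close> against
    \<open>y + D\<close> then bounds the gain by the cost of \<open>D\<close>.\<close>
  have "b' * (ln (u y + a) - ln (u y)) \<le> b * (ln (u y + a) - ln (u y))"
    using b ex(5) y0 by (intro mult_right_mono) auto
  also have "\<dots> \<le> b * (ln (u (y + D)) - ln (u y))"
    using b ln_ge by simp
  also have "\<dots> \<le> q \<bullet> D"
    using opt[OF yD u_pos(1)] by (simp add: inner_simps algebra_simps)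
  \<comment> \<open>\<open>D\<close> is nonpositive on every good whose price differs, and there
    \<open>q'\<close> is the smaller price.\<close>
  also have "\<dots> \<le> q' \<bullet> D"
  proof -
    have "q $ j * D $ j \<le> q' $ j * D $ j" for j
    proof (cases "q' $ j = q $ j")
      case False
      then show ?thesis using DN(1)[of j] comp(3)[of j] by (simp add: mult_right_mono_neg)
    qed simp
    then show ?thesis by (simp add: inner_vec_def sum_mono)
  qed
  finally have cost: "b' * (ln (u y + a) - ln (u y)) \<le> q' \<bullet> D" .
  \<comment> \<open>Concavity of the logarithm in product form: two values moved towards each other
    with the same sum have a larger product.\<close>
  have "u y * u y' \<le> (u y + a) * (u y' - a)"
  proof (cases "a = 0")
    case False
    with ex(5,6) have "0 \<le> a * (u y' - u y - a)" by (intro mult_nonneg_nonneg) auto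
    then show ?thesis by (simp add: algebra_simps)
  qed simp
  then have "ln (u y * u y') \<le> ln ((u y + a) * (u y' - a))"
    using y0 y'0 a by (simp add: ln_mono)
  then have "ln (u y) + ln (u y') \<le> ln (u y + a) + ln (u y' - a)"
    using y0 y'0 a by (simp add: ln_mult)
  then have "b' * ln (u y') \<le> b' * (ln (u y + a) - ln (u y) + ln (u (y' - D)))"
    using b ln_ge by simp
  with cost have "b' * ln (u y') - q' \<bullet> y' \<le> b' * ln (u (y' - D)) - q' \<bullet> (y' - D)"
    by (simp add: inner_simps algebra_simps)
  with opt' have "y' - D \<in> gale_demand u q' b'"
    unfolding demand_iff using y'D u_pos(2) by fastforce
  \<comment> \<open>If \<open>y'\<close> exceeds \<open>y\<close> at \<open>j\<close>, all of the
    excess was moved and equality holds; otherwise \<open>D\<close> removes at most the deficit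
    \<open>y' - y\<close>.\<close>
  moreover have "(y' - D) $ j \<le> y $ j" if "q' $ j = q $ j" for j
    using that DP[of j] DN[of j] by (cases "y $ j < y' $ j") auto
  ultimately show ?thesis by blast
qed

lemma gale_substitutes: "gale_substitutes u"
  unfolding gale_substitutes_def
proof (intro conjI allI ballI impI)
  fix b :: real and q q' y
  assume "0 < b" "q' \<in> price_domain u" "y \<in> gale_demand u q b" "q' \<le> q"
  then show "\<exists>y'\<in>gale_demand u q' b. \<forall>j. q' $ j = q $ j \<longrightarrow> y' $ j \<le> y $ j"
    by (intro gale_demand_monotone) auto
next
  fix b b' :: real and q y
  assume "b' \<le> b \<and> 0 < b'" "q \<in> price_domain u" "y \<in> gale_demand u q b"
  then have "\<exists>y'\<in>gale_demand u q b'. \<forall>j. q $ j = q $ j \<longrightarrow> y' $ j \<le> y $ j"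
    by (intro gale_demand_monotone) auto
  then show "\<exists>y'\<in>gale_demand u q b'. y' \<le> y" by (simp add: less_eq_vec_def)
qed

end

theorem theorem1p5:
  fixes u :: "real ^ 'm::finite \<Rightarrow> real"
  assumes "generalized_network_utility TYPE('v) TYPE('e) u"
  shows "gale_substitutes u"
proof -
  obtain G :: "('v, 'e) pre_digraph" and t S h \<gamma> and s :: "'m \<Rightarrow> 'v"
    where inst: "generalized_flow_instance G t S h \<gamma>" and s: "bij_betw s UNIV S"
      and max: "\<forall>x\<ge>0. is_max_flow_value G t S h \<gamma> (\<lambda>v. x $ inv s v) (u x)"
      and u: "\<forall>x\<ge>0. 0 \<le> u x" "\<exists>x\<ge>0. u x > 0"
    using assms unfolding generalized_network_utility_def by blast
  interpret generalized_flow_instance G t S h \<gamma> by (rule inst)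
  interpret network_utility G t S h \<gamma> s u
    by unfold_locales (use s max u in auto)
  show ?thesis by (rule gale_substitutes)
qed

end
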